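(* Let $U,V$ be proper subsets of $S^3$ and assume that $\partial U,\partial V$ are both tame. Let $\mathcal{U}\in\partial U$ and $\mathcal{V}\in\partial V$. If $\mathcal{U}\mathcal{V}$ belongs to $\partial(U\otimes V)$, then \[ \mathcal{U}^*\,(T_{\mathcal{U}}(\partial U))=(T_{\mathcal{V}}(\partial V))\,\mathcal{V}^*. \] Furthermore, for each spherical cap $U(\mathcal{U}_0,s)\subseteq U$ with $s\in(0,\tfrac12\pi)$ whose boundary is tangent to $\partial U$ at $\mathcal{U}$, and each spherical cap $U(\mathcal{V}_0,t)\subseteq V$ with $t\in(0,\tfrac12\pi)$ whose boundary is tangent to $\partial V$ at $\mathcal{V}$, we have \[ \mathcal{U}^*\,U(\mathcal{U}_0,s)\subseteq U(\mathcal{V}_0,t)\,\mathcal{V}^* \quad\text{or}\quad \mathcal{U}^*\,U(\mathcal{U}_0,s)\supseteq U(\mathcal{V}_0,t)\,\mathcal{V}^*. \]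
   Context: $\mathbb{H}$ denotes the real quaternions, identified with $\mathbb{R}^4$ with its Euclidean inner product $\langle\cdot,\cdot\rangle$; $S^3\subset\mathbb{H}$ is the set of unit quaternions; $\mathcal{U}^*$ is the quaternionic conjugate. For subsets $A,B\subseteq\mathbb{H}$, $A\otimes B=\{ab:a\in A,\ b\in B\}$, and for a quaternion $\mathcal{Q}$, $\mathcal{Q}A=\{\mathcal{Q}a:a\in A\}$, $A\mathcal{Q}=\{a\mathcal{Q}:a\in A\}$. The symbol $\partial$ denotes boundary in the topology of $S^3$ induced by $\mathbb{R}^4$. For $\mathcal{P}\in S^3$ and $r\in[0,\pi]$, the spherical cap is $U(\mathcal{P},r):=\{\mathcal{W}\in S^3:\langle\mathcal{W},\mathcal{P}\rangle\ge\cos r\}$. Tame boundary: for $U\subset S^3$, the boundary $\partial U$ is tame if, for every $\mathcal{U}_0\in\partial U$: (1) $U$ includes a spherical cap $U(\mathcal{P},s)$ with $s>0$ such that $U(\mathcal{P},s)\cap\partial U=\{\mathcal{U}_0\}$; and (2) the set of all tangent vectors at $\mathcal{U}_0$ to curves in $\partial U$ through $\mathcal{U}_0$ spans a $2$-plane, denoted $T_{\mathcal{U}_0}\partial U$ (also written $T_{\mathcal{U}_0}(\partial U)$) and called the tangent plane to $\partial U$ at $\mathcal{U}_0$; it is a $2$-dimensional linear subspace of $\mathbb{H}$. (A curve through $\mathcal{U}_0$ is differentiable, defined on an open interval, and takes the value $\mathcal{U}_0$ at a point of that interval.) The boundary of a spherical cap is tangent to $\partial U$ at $\mathcal{U}\in\partial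 U$ if it passes through $\mathcal{U}$ and its tangent plane at $\mathcal{U}$ (as a $2$-sphere) equals $T_{\mathcal{U}}\partial U$. *)

theory Defs
  imports "HOL-Analysis.Analysis"
begin

text \<open>
  The quaternion \<open>a + b i + c j + d k\<close> is the vector with components \<open>a, b, c, d\<close>.
  Inner product, norm and topology are those of \<open>real ^ 4\<close>; the product needs its own
  symbol because \<open>*\<close> on \<open>real ^ 4\<close> is the componentwise product.
\<close>

type_synonym quat = "real ^ 4"

definition quat :: "real \<Rightarrow> real \<Rightarrow> real \<Rightarrow> real \<Rightarrow> quat" where
  "quat a b c d = vector [a, b, c, d]"

definition qmult :: "quat \<Rightarrow> quat \<Rightarrow> quat"  (infixl "*\<^sub>q" 70) where
  "x *\<^sub>q y = quat
     (x$1 * y$1 - x$2 * y$2 - x$3 * y$3 - x$4 * y$4)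
     (x$1 * y$2 + x$2 * y$1 + x$3 * y$4 - x$4 * y$3)
     (x$1 * y$3 - x$2 * y$4 + x$3 * y$1 + x$4 * y$2)
     (x$1 * y$4 + x$2 * y$3 - x$3 * y$2 + x$4 * y$1)"

definition qcnj :: "quat \<Rightarrow> quat" where
  "qcnj x = quat (x$1) (- x$2) (- x$3) (- x$4)"

lemma quat_nth [simp]:
  "quat a b c d $ 1 = a" "quat a b c d $ 2 = b" "quat a b c d $ 3 = c" "quat a b c d $ 4 = d"
  by (simp_all add: quat_def vector_def)

lemma quat_eq_iff: "x = y \<longleftrightarrow> x$1 = y$1 \<and> x$2 = y$2 \<and> x$3 = y$3 \<and> x$4 = y$4"
  for x y :: quat
  by (simp add: vec_eq_iff forall_4)

lemma qmult_basis:
  "quat 0 1 0 0 *\<^sub>q quat 0 1 0 0 = quat (-1) 0 0 0"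
  "quat 0 0 1 0 *\<^sub>q quat 0 0 1 0 = quat (-1) 0 0 0"
  "quat 0 0 0 1 *\<^sub>q quat 0 0 0 1 = quat (-1) 0 0 0"
  "quat 0 1 0 0 *\<^sub>q quat 0 0 1 0 = quat 0 0 0 1"
  "quat 0 0 1 0 *\<^sub>q quat 0 0 0 1 = quat 0 1 0 0"
  "quat 0 0 0 1 *\<^sub>q quat 0 1 0 0 = quat 0 0 1 0"
  by (simp_all add: quat_eq_iff qmult_def)

lemma qmult_one [simp]: "quat 1 0 0 0 *\<^sub>q x = x" "x *\<^sub>q quat 1 0 0 0 = x"
  by (simp_all add: quat_eq_iff qmult_def)

lemma qmult_assoc: "(x *\<^sub>q y) *\<^sub>q z = x *\<^sub>q (y *\<^sub>q z)"
  by (simp add: quat_eq_iff qmult_def algebra_simps)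

lemma qmult_qcnj: "x *\<^sub>q qcnj x = quat (x \<bullet> x) 0 0 0" "qcnj x *\<^sub>q x = quat (x \<bullet> x) 0 0 0"
  by (simp_all add: quat_eq_iff qmult_def qcnj_def inner_vec_def sum_4)

abbreviation S3 :: "quat set" where
  "S3 \<equiv> sphere 0 1"

definition set_qmult :: "quat set \<Rightarrow> quat set \<Rightarrow> quat set"  (infixl "\<otimes>\<^sub>q" 70) where
  "A \<otimes>\<^sub>q B = {a *\<^sub>q b | a b. a \<in> A \<and> b \<in> B}"

definition left_mult :: "quat \<Rightarrow> quat set \<Rightarrow> quat set" where
  "left_mult q A = (\<lambda>a. q *\<^sub>q a) ` A"

definition right_mult :: "quat set \<Rightarrow> quat \<Rightarrow> quat set" where
  "right_mult A q = (\<lambda>a. a *\<^sub>q q) ` A"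

definition bdry :: "quat set \<Rightarrow> quat set" where
  "bdry A = top_of_set S3 frontier_of A"

definition cap :: "quat \<Rightarrow> real \<Rightarrow> quat set" where
  "cap p r = {w \<in> S3. w \<bullet> p \<ge> cos r}"

definition tangent_vectors :: "quat set \<Rightarrow> quat \<Rightarrow> quat set" where
  "tangent_vectors X x =
     {v. \<exists>(\<gamma> :: real \<Rightarrow> quat) I \<tau>.
           open I \<and> is_interval I \<and> \<tau> \<in> I \<and> \<gamma> differentiable_on I \<and> \<gamma> ` I \<subseteq> X \<and>
           \<gamma> \<tau> = x \<and> (\<gamma> has_vector_derivative v) (at \<tau>)}"

text \<open>
  The two definitions below take the boundary surface itself, so that they apply both to
  the boundary of a given set and to the boundary 2-sphere of a cap.
\<close>

definition tangent_plane :: "quat set \<Rightarrow> quat \<Rightarrow> quat set" where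
  "tangent_plane X x = span (tangent_vectors X x)"

definition tangent_at :: "quat set \<Rightarrow> quat set \<Rightarrow> quat \<Rightarrow> bool" where
  "tangent_at Y X x \<longleftrightarrow> x \<in> Y \<and> tangent_plane Y x = tangent_plane X x"

definition tame_boundary :: "quat set \<Rightarrow> bool" where
  "tame_boundary U \<longleftrightarrow>
     (\<forall>u \<in> bdry U.
        (\<exists>p \<in> S3. \<exists>s. 0 < s \<and> s \<le> pi \<and> cap p s \<subseteq> U \<and> cap p s \<inter> bdry U = {u}) \<and>
        dim (tangent_plane (bdry U) u) = 2)"

end

theory Submission
  imports Defs
begin

text \<open>
  Multiplying \<open>U\<close> on the left by \<open>u\<^sup>*\<close> and \<open>V\<close> on the right by \<open>v\<^sup>*\<close> moves both boundary points
  to the quaternion \<open>1\<close>. A cap inside \<open>U\<close> whose boundary passes through \<open>u\<close> then becomes a cap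
  through \<open>1\<close> with centre \<open>cos s + (sin s) a\<close>, and a cap inside \<open>V\<close> through \<open>v\<close> becomes a cap
  with centre \<open>cos t + (sin t) b\<close>; here the unit imaginary quaternions \<open>a\<close> and \<open>b\<close> are the
  inward normals of the two caps at \<open>1\<close>.

  Everything follows from \<open>a = b\<close>. If \<open>a \<noteq> b\<close>, then moving from \<open>1\<close> in the direction \<open>a - b\<close>
  enters the first cap, and moving in the opposite direction enters the second. Hence some
  unit quaternion \<open>z\<close> close to \<open>1\<close> lies in the interior of the first cap while its inverse lies
  in the interior of the second (\<open>exists_inner_factor_pair\<close>). Keeping the left factor \<open>u z\<close>
  fixed and varying the right factor around \<open>z\<^sup>* v\<close> covers a whole neighbourhood of \<open>u v\<close>
  in the product, so \<open>u v\<close> is not a boundary point (\<open>inward_normals_agree\<close>).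

  The tangent plane at \<open>u\<close> is the orthogonal complement of \<open>u\<close> and the centre of any cap
  inside \<open>U\<close> whose boundary passes through \<open>u\<close>: along a curve in \<open>\<partial>U\<close> the inner product with
  the centre is maximal at \<open>u\<close>, and the dimension prescribed by tameness leaves no room for a
  smaller space (\<open>tangent_plane_eq_orthogonal\<close>). So equal normals give equal tangent planes,
  and two caps through \<open>1\<close> with the same inward normal are nested according to their radii
  (\<open>cap_mono_common_normal\<close>).
\<close>

section \<open>Multiplication by unit quaternions\<close>

abbreviation qone :: quat where
  "qone \<equiv> quat 1 0 0 0"

lemma inner_quat: "x \<bullet> y = x$1 * y$1 + x$2 * y$2 + x$3 * y$3 + x$4 * y$4" for x y :: quat
  by (simp add: inner_vec_def sum_4)

lemma inner_qone: "x \<bullet> qone = x $ 1"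
  by (simp add: inner_quat)

lemma S3_iff_inner: "x \<in> S3 \<longleftrightarrow> x \<bullet> x = 1"
  by (simp add: norm_eq_1)

lemma inner_qmult_left: "(q *\<^sub>q x) \<bullet> y = x \<bullet> (qcnj q *\<^sub>q y)"
  by (simp add: inner_quat qmult_def qcnj_def algebra_simps)

lemma inner_qmult_right: "(x *\<^sub>q q) \<bullet> y = x \<bullet> (y *\<^sub>q qcnj q)"
  by (simp add: inner_quat qmult_def qcnj_def algebra_simps)

lemma qcnj_qcnj [simp]: "qcnj (qcnj x) = x"
  by (simp add: quat_eq_iff qcnj_def)

lemma inner_qcnj: "qcnj x \<bullet> y = x \<bullet> qcnj y"
  by (simp add: inner_quat qcnj_def)

lemma qcnj_in_S3: "x \<in> S3 \<Longrightarrow> qcnj x \<in> S3"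
  by (simp only: S3_iff_inner inner_qcnj qcnj_qcnj)

lemma qcnj_cancel:
  assumes "q \<in> S3"
  shows "qcnj q *\<^sub>q q = qone" "q *\<^sub>q qcnj q = qone"
    "qcnj q *\<^sub>q (q *\<^sub>q x) = x" "q *\<^sub>q (qcnj q *\<^sub>q x) = x"
    "(x *\<^sub>q q) *\<^sub>q qcnj q = x" "(x *\<^sub>q qcnj q) *\<^sub>q q = x"
proof -
  show *: "qcnj q *\<^sub>q q = qone" "q *\<^sub>q qcnj q = qone"
    using assms unfolding S3_iff_inner by (simp_all add: qmult_qcnj)
  show "qcnj q *\<^sub>q (q *\<^sub>q x) = x" "q *\<^sub>q (qcnj q *\<^sub>q x) = x"
    by (simp_all flip: qmult_assoc add: *)
  show "(x *\<^sub>q q) *\<^sub>q qcnj q = x" "(x *\<^sub>q qcnj q) *\<^sub>q q = x"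
    by (simp_all add: qmult_assoc *)
qed

lemma qmult_in_S3: "x \<in> S3 \<Longrightarrow> y \<in> S3 \<Longrightarrow> x *\<^sub>q y \<in> S3"
  by (metis S3_iff_inner inner_qmult_left qcnj_cancel(3))

lemma left_mult_Collect:
  assumes "q \<in> S3"
  shows "left_mult (qcnj q) {x. P x} = {y. P (q *\<^sub>q y)}"
  unfolding left_mult_def image_def by (auto simp: qcnj_cancel[OF assms])

lemma right_mult_Collect:
  assumes "q \<in> S3"
  shows "right_mult {x. P x} (qcnj q) = {y. P (y *\<^sub>q q)}"
  unfolding right_mult_def image_def by (auto simp: qcnj_cancel[OF assms])

lemma left_mult_cap:
  assumes "q \<in> S3"
  shows "left_mult (qcnj q) (cap p r) = cap (qcnj q *\<^sub>q p) r"
proof -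
  have "q *\<^sub>q y \<in> S3 \<longleftrightarrow> y \<in> S3" for y
    using assms by (metis qcnj_cancel(3) qcnj_in_S3 qmult_in_S3)
  then show ?thesis
    unfolding cap_def left_mult_Collect[OF assms] inner_qmult_left by simp
qed

lemma right_mult_cap:
  assumes "q \<in> S3"
  shows "right_mult (cap p r) (qcnj q) = cap (p *\<^sub>q qcnj q) r"
proof -
  have "y *\<^sub>q q \<in> S3 \<longleftrightarrow> y \<in> S3" for y
    using assms by (metis qcnj_cancel(5) qcnj_in_S3 qmult_in_S3)
  then show ?thesis
    unfolding cap_def right_mult_Collect[OF assms] inner_qmult_right by simp
qed

section \<open>Caps and boundary points\<close>

lemma bdry_subset_S3: "bdry A \<subseteq> S3"
  unfolding bdry_def using frontier_of_subset_topspace[of "top_of_set S3" A] by simp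

lemma bdry_not_in_open:
  assumes "x \<in> bdry A" "openin (top_of_set S3) T" "T \<subseteq> A"
  shows "x \<notin> T"
  using assms interior_of_maximal[of T A "top_of_set S3"]
  unfolding bdry_def frontier_of_def by blast

lemma openin_inner_gt: "openin (top_of_set S3) {w \<in> S3. w \<bullet> p > c}"
proof -
  have "open {w. w \<bullet> p > c}"
    by (intro open_Collect_less continuous_intros)
  then show ?thesis
    using openin_open_Int[of "{w. w \<bullet> p > c}" S3] by (simp add: Int_def conj_commute)
qed

lemma inner_le_cos_on_bdry:
  assumes "cap p s \<subseteq> A" "x \<in> bdry A"
  shows "x \<bullet> p \<le> cos s"
proof (rule ccontr)
  assume "\<not> x \<bullet> p \<le> cos s"
  moreover have "x \<notin> {w \<in> S3. w \<bullet> p > cos s}"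
    using assms by (intro bdry_not_in_open[OF assms(2) openin_inner_gt]) (auto simp: cap_def)
  moreover have "x \<in> S3"
    using assms(2) bdry_subset_S3 by blast
  ultimately show False
    by simp
qed

lemma bdry_cap_subset: "bdry (cap p s) \<subseteq> cap p s"
proof -
  have "{w. w \<bullet> p \<ge> cos s} \<inter> S3 = cap p s"
    by (auto simp: cap_def)
  moreover have "closed {w. w \<bullet> p \<ge> cos s}"
    by (intro closed_Collect_le continuous_intros)
  ultimately have "closedin (top_of_set S3) (cap p s)"
    using closedin_closed_Int[of "{w. w \<bullet> p \<ge> cos s}" S3] by (simp add: Int_commute)
  then show ?thesis
    unfolding bdry_def by (rule frontier_of_subset_closedin)
qed

lemma inner_eq_cos_on_bdry:
  assumes "cap p s \<subseteq> A" "x \<in> bdry A" "x \<in> cap p s"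
  shows "x \<bullet> p = cos s"
  using inner_le_cos_on_bdry[OF assms(1,2)] assms(3) by (simp add: cap_def)

lemma cap_pi:
  assumes "p \<in> S3"
  shows "cap p pi = S3"
proof -
  have "\<bar>w \<bullet> p\<bar> \<le> 1" if "w \<in> S3" for w
    using Cauchy_Schwarz_ineq2[of w p] that assms by simp
  then show ?thesis
    unfolding cap_def by (auto simp: abs_le_iff)
qed

text \<open>
  The radius is less than \<open>\<pi>\<close> because a cap of radius \<open>\<pi>\<close> is all of \<open>S3\<close>
  and so does not fit into the proper subset \<open>A\<close>.
\<close>

lemma tame_boundary_obtain_cap:
  assumes "tame_boundary A" "A \<subset> S3" "x \<in> bdry A"
  obtains p s where "p \<in> S3" "s \<in> {0<..<pi}" "cap p s \<subseteq> A" "x \<bullet> p = cos s"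
proof -
  obtain p s where p: "p \<in> S3" "0 < s" "s \<le> pi" "cap p s \<subseteq> A" "cap p s \<inter> bdry A = {x}"
    using assms unfolding tame_boundary_def by blast
  moreover have "s \<noteq> pi"
    using p assms(2) cap_pi by blast
  moreover have "x \<bullet> p = cos s"
    using p assms(3) by (intro inner_eq_cos_on_bdry) auto
  ultimately show ?thesis
    using that[of p s] by simp
qed

section \<open>Tangent planes\<close>

text \<open>
  A curve in \<open>X\<close> through a maximum point of a linear functional on \<open>X\<close> has a critical point of
  that functional there.
\<close>

lemma tangent_vector_orthogonal_at_max:
  assumes "w \<in> tangent_vectors X x" "\<And>y. y \<in> X \<Longrightarrow> y \<bullet> p \<le> x \<bullet> p"
  shows "w \<bullet> p = 0"
proof -
  obtain \<gamma> I \<tau> where \<gamma>: "open I" "\<tau> \<in> I" "\<gamma> ` I \<subseteq> X" "\<gamma> \<tau> = x"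
    "(\<gamma> has_vector_derivative w) (at \<tau>)"
    using assms(1) unfolding tangent_vectors_def by blast
  have "((\<lambda>r. \<gamma> r \<bullet> p) has_vector_derivative w \<bullet> p) (at \<tau>)"
    by (rule bounded_linear.has_vector_derivative[OF bounded_linear_inner_left \<gamma>(5)])
  then have deriv: "((\<lambda>r. \<gamma> r \<bullet> p) has_real_derivative w \<bullet> p) (at \<tau>)"
    by (simp add: has_real_derivative_iff_has_vector_derivative)
  obtain d where "d > 0" "ball \<tau> d \<subseteq> I"
    using \<gamma>(1,2) open_contains_ball by blast
  then have "\<forall>r. \<bar>\<tau> - r\<bar> < d \<longrightarrow> \<gamma> r \<bullet> p \<le> \<gamma> \<tau> \<bullet> p"
    using assms(2) \<gamma>(3,4) by (auto simp: subset_iff dist_real_def)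
  with deriv \<open>d > 0\<close> show ?thesis
    by (rule DERIV_local_max)
qed

lemma dim_orthogonal_pair_le:
  fixes u p :: quat
  assumes "u \<noteq> 0" "p \<notin> span {u}"
  shows "dim {x. x \<bullet> u = 0 \<and> x \<bullet> p = 0} \<le> 2"
proof -
  have "independent {p, u}"
    using assms by (simp add: independent_insert)
  moreover have "p \<noteq> u"
    using assms(2) span_base by auto
  ultimately have "dim (span {p, u}) = 2"
    by (simp add: dim_eq_card_independent)
  moreover have "dim {x \<in> UNIV. \<forall>y \<in> span {p, u}. orthogonal y x} + dim (span {p, u})
      = dim (UNIV :: quat set)"
    by (intro dim_subspace_orthogonal_to_vectors) auto
  moreover have "{x. x \<bullet> u = 0 \<and> x \<bullet> p = 0} \<subseteq> {x \<in> UNIV. \<forall>y \<in> span {p, u}. orthogonal y x}"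
  proof clarsimp
    fix x y assume "x \<bullet> u = 0" "x \<bullet> p = 0" "y \<in> span {p, u}"
    then have "orthogonal x y"
      by (intro orthogonal_to_span[of y "{p, u}"]) (auto simp: orthogonal_def)
    then show "orthogonal y x"
      by (simp add: orthogonal_commute)
  qed
  ultimately show ?thesis
    using dim_subset[of "{x. x \<bullet> u = 0 \<and> x \<bullet> p = 0}"
        "{x \<in> UNIV. \<forall>y \<in> span {p, u}. orthogonal y x}"] by simp
qed

text \<open>
  Both \<open>u\<close> and \<open>p\<close> define linear functionals that are maximal at \<open>u\<close> on \<open>\<partial>A\<close>: the first because
  \<open>\<partial>A\<close> lies on the unit sphere, the second because \<open>\<partial>A\<close> avoids the interior of the cap.
\<close>

lemma tangent_plane_eq_orthogonal:
  assumes "tame_boundary A" "u \<in> bdry A"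
    and "p \<in> S3" "s \<in> {0<..<pi}" "cap p s \<subseteq> A" "u \<bullet> p = cos s"
  shows "tangent_plane (bdry A) u = {x. x \<bullet> u = 0 \<and> x \<bullet> p = 0}" (is "_ = ?T")
proof -
  have u: "u \<bullet> u = 1" and p: "p \<bullet> p = 1"
    using assms(2,3) bdry_subset_S3 S3_iff_inner by blast+
  have "w \<bullet> u = 0" if "w \<in> tangent_vectors (bdry A) u" for w
  proof (rule tangent_vector_orthogonal_at_max[OF that])
    fix y assume "y \<in> bdry A"
    then have "y \<in> S3" "u \<in> S3"
      using bdry_subset_S3 assms(2) by blast+
    then show "y \<bullet> u \<le> u \<bullet> u"
      using norm_cauchy_schwarz[of y u] u by simp
  qed
  moreover have "w \<bullet> p = 0" if "w \<in> tangent_vectors (bdry A) u" for w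
    using inner_le_cos_on_bdry[OF assms(5)] assms(6)
    by (intro tangent_vector_orthogonal_at_max[OF that]) simp
  moreover have T: "subspace ?T"
    by (auto simp: subspace_def inner_left_distrib)
  ultimately have sub: "tangent_plane (bdry A) u \<subseteq> ?T"
    unfolding tangent_plane_def by (intro span_minimal) auto
  have "p \<notin> span {u}"
  proof
    assume "p \<in> span {u}"
    then obtain k where k: "p = k *\<^sub>R u"
      by (auto simp: span_singleton)
    then have "k = cos s" "k\<^sup>2 = 1"
      using assms(6) u p by (simp_all add: power2_eq_square)
    then have "sin s = 0"
      using sin_cos_squared_add[of s] by simp
    then show False
      using sin_gt_zero[of s] assms(4) by simp
  qed
  moreover have "u \<noteq> 0"
    using u by auto
  ultimately have "dim ?T \<le> 2"
    by (intro dim_orthogonal_pair_le)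
  then have "dim ?T \<le> dim (tangent_plane (bdry A) u)"
    using assms(1,2) unfolding tame_boundary_def by simp
  then show ?thesis
    using sub T by (intro subspace_dim_equal) (auto simp: tangent_plane_def)
qed

section \<open>Inward normals of caps through 1\<close>

text \<open>
  For a cap with centre \<open>p\<close> and radius \<open>s\<close> whose boundary passes through \<open>1\<close>, this is the unit
  tangent vector at \<open>1\<close> that points towards \<open>p\<close>.
\<close>

definition inward_normal :: "quat \<Rightarrow> real \<Rightarrow> quat" where
  "inward_normal p s = (p - cos s *\<^sub>R qone) /\<^sub>R sin s"

lemma center_eq:
  assumes "s \<in> {0<..<pi}"
  shows "p = cos s *\<^sub>R qone + sin s *\<^sub>R inward_normal p s"
  using assms sin_gt_zero[of s] by (simp add: inward_normal_def)

lemma inward_normal_imaginary: "p $ 1 = cos s \<Longrightarrow> inward_normal p s $ 1 = 0"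
  by (simp add: inward_normal_def)

lemma inward_normal_unit:
  assumes "p \<in> S3" "s \<in> {0<..<pi}" "p $ 1 = cos s"
  shows "inward_normal p s \<bullet> inward_normal p s = 1"
proof -
  let ?a = "inward_normal p s"
  have "1 = p \<bullet> p"
    using assms(1) by (simp add: norm_eq_1)
  also have "\<dots> = (cos s *\<^sub>R qone + sin s *\<^sub>R ?a) \<bullet> (cos s *\<^sub>R qone + sin s *\<^sub>R ?a)"
    using center_eq[OF assms(2), of p] by simp
  also have "\<dots> = (cos s)\<^sup>2 + (sin s)\<^sup>2 * (?a \<bullet> ?a)"
    by (simp add: inner_left_distrib inner_right_distrib inner_qone inner_commute[of qone]
        inward_normal_imaginary[OF assms(3)] power2_eq_square)
  finally have "(sin s)\<^sup>2 * (?a \<bullet> ?a) = (sin s)\<^sup>2"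
    using sin_cos_squared_add[of s] by linarith
  then show ?thesis
    using sin_gt_zero[of s] assms(2) by simp
qed

text \<open>
  Moving by \<open>\<epsilon> c\<close> from \<open>1\<close> raises the inner product with the centre by the first-order amount
  \<open>\<epsilon> (sin s) (c \<bullet> a)\<close>. Projecting back to the sphere divides by a norm of at most
  \<open>1 + \<epsilon>\<^sup>2 |c|\<^sup>2 / 2\<close>, which is only a second-order loss. When \<open>c \<bullet> a = |c|\<^sup>2 / 2\<close>, as for \<open>c = a - b\<close> with \<open>a\<close> and \<open>b\<close> unit
  vectors, the gain wins as soon as \<open>\<epsilon> < sin s\<close>.
\<close>

lemma normalized_step_enters_cap:
  assumes "c $ 1 = 0" "c \<noteq> 0" "c \<bullet> a = c \<bullet> c / 2" "a $ 1 = 0"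
    and "0 < \<epsilon>" "\<epsilon> < sin s"
  shows "((qone + \<epsilon> *\<^sub>R c) /\<^sub>R norm (qone + \<epsilon> *\<^sub>R c)) \<bullet> (cos s *\<^sub>R qone + sin s *\<^sub>R a) > cos s"
proof -
  define k where "k = c \<bullet> c / 2"
  define N where "N = norm (qone + \<epsilon> *\<^sub>R c)"
  have k: "k > 0"
    using assms(2) by (simp add: k_def)
  have "(qone + \<epsilon> *\<^sub>R c) \<bullet> (qone + \<epsilon> *\<^sub>R c) = 1 + 2 * (\<epsilon>\<^sup>2 * k)"
    using assms(1) by (simp add: inner_left_distrib inner_right_distrib inner_qone
        inner_commute[of qone] k_def power2_eq_square)
  then have N: "N = sqrt (1 + 2 * (\<epsilon>\<^sup>2 * k))"
    by (simp add: N_def norm_eq_sqrt_inner)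
  have "1 + 2 * (\<epsilon>\<^sup>2 * k) \<le> (1 + \<epsilon>\<^sup>2 * k)\<^sup>2"
    by (simp add: power2_sum)
  then have N_le: "N \<le> 1 + \<epsilon>\<^sup>2 * k"
    unfolding N using k by (intro real_le_lsqrt) auto
  have N_ge: "N \<ge> 1"
    unfolding N using k by simp
  have "cos s * (N - 1) \<le> 1 * (N - 1)"
    using N_ge by (intro mult_right_mono) auto
  also have "\<dots> \<le> \<epsilon> * (\<epsilon> * k)"
    using N_le by (simp add: power2_eq_square)
  also have "\<dots> < sin s * (\<epsilon> * k)"
    using assms(5,6) k by (intro mult_strict_right_mono) auto
  finally have "cos s * N < cos s + \<epsilon> * sin s * k"
    by (simp add: algebra_simps)
  also have "\<dots> = (qone + \<epsilon> *\<^sub>R c) \<bullet> (cos s *\<^sub>R qone + sin s *\<^sub>R a)"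
    using assms(1,3,4) by (simp add: inner_left_distrib inner_right_distrib inner_qone
        inner_commute[of qone] k_def)
  finally show ?thesis
    using N_ge unfolding N_def[symmetric] inner_scaleR_left by (simp add: field_simps)
qed

text \<open>
  Conjugation reverses the imaginary part, so \<open>z\<close> moves in the direction \<open>a - b\<close> of the
  difference of the normals while \<open>qcnj z\<close>, its inverse, moves in the direction \<open>b - a\<close>.
\<close>

lemma exists_inner_factor_pair:
  assumes p: "p \<in> S3" "s \<in> {0<..<pi}" "p $ 1 = cos s"
    and q: "q \<in> S3" "t \<in> {0<..<pi}" "q $ 1 = cos t"
    and neq: "inward_normal p s \<noteq> inward_normal q t"
  obtains z where "z \<in> S3" "z \<bullet> p > cos s" "qcnj z \<bullet> q > cos t"
proof -
  define a b where "a = inward_normal p s" and "b = inward_normal q t"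
  define c where "c = a - b"
  define \<epsilon> where "\<epsilon> = min (sin s) (sin t) / 2"
  define z where "z = (qone + \<epsilon> *\<^sub>R c) /\<^sub>R norm (qone + \<epsilon> *\<^sub>R c)"
  have a: "a \<bullet> a = 1" "a $ 1 = 0" and b: "b \<bullet> b = 1" "b $ 1 = 0"
    using p q by (simp_all add: a_def b_def inward_normal_unit inward_normal_imaginary)
  have c: "c $ 1 = 0" "c \<noteq> 0"
    using neq a b by (simp_all add: c_def a_def b_def)
  have ca: "c \<bullet> a = c \<bullet> c / 2" "- c \<bullet> b = - c \<bullet> - c / 2"
    using a b by (simp_all add: c_def inner_diff_left inner_diff_right inner_commute)
  have "sin s > 0" "sin t > 0"
    using p(2) q(2) sin_gt_zero by auto
  then have \<epsilon>: "0 < \<epsilon>" "\<epsilon> < sin s" "\<epsilon> < sin t"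
    by (auto simp: \<epsilon>_def min_def)
  have nz: "qone + \<epsilon> *\<^sub>R c \<noteq> 0"
    using c(1) by (simp add: quat_eq_iff)
  have cz: "qcnj z = (qone + \<epsilon> *\<^sub>R (- c)) /\<^sub>R norm (qone + \<epsilon> *\<^sub>R (- c))"
  proof -
    have "norm (qone + \<epsilon> *\<^sub>R (- c)) = norm (qone + \<epsilon> *\<^sub>R c)"
      using c(1) by (simp add: norm_eq_sqrt_inner inner_quat)
    then show ?thesis
      using c(1) by (simp add: z_def qcnj_def quat_eq_iff)
  qed
  show ?thesis
  proof
    show "z \<in> S3"
      using nz by (simp add: z_def)
    show "z \<bullet> p > cos s"
      using normalized_step_enters_cap[OF c ca(1) a(2) \<epsilon>(1,2)]
      by (simp add: z_def a_def flip: center_eq[OF p(2)])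
    show "qcnj z \<bullet> q > cos t"
      unfolding cz using normalized_step_enters_cap[OF _ _ ca(2) b(2) \<epsilon>(1,3)] c
      by (simp add: b_def flip: center_eq[OF q(2)])
  qed
qed

text \<open>
  If the normals differ, \<open>u v\<close> is the product of a point \<open>u z\<close> of \<open>A\<close> and a point \<open>z\<^sup>* v\<close> in the
  interior of \<open>B\<close>, so the translate by \<open>u z\<close> of that interior is an open subset of the product.
\<close>

lemma inward_normals_agree:
  assumes u: "u \<in> S3" and v: "v \<in> S3" and uv: "u *\<^sub>q v \<in> bdry (A \<otimes>\<^sub>q B)"
    and p: "p \<in> S3" "s \<in> {0<..<pi}" "cap p s \<subseteq> A" "u \<bullet> p = cos s"
    and q: "q \<in> S3" "t \<in> {0<..<pi}" "cap q t \<subseteq> B" "v \<bullet> q = cos t"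
  shows "inward_normal (qcnj u *\<^sub>q p) s = inward_normal (q *\<^sub>q qcnj v) t"
proof (rule ccontr)
  assume neq: "\<not> ?thesis"
  have 1: "(qcnj u *\<^sub>q p) $ 1 = cos s" "(q *\<^sub>q qcnj v) $ 1 = cos t"
    using p(4) q(4) inner_qmult_left[of "qcnj u" p qone] inner_qmult_right[of q "qcnj v" qone]
    by (simp_all add: inner_qone inner_commute)
  obtain z where z: "z \<in> S3" "z \<bullet> (qcnj u *\<^sub>q p) > cos s" "qcnj z \<bullet> (q *\<^sub>q qcnj v) > cos t"
    using exists_inner_factor_pair[OF _ p(2) 1(1) _ q(2) 1(2) neq] u v p(1) q(1)
      qmult_in_S3 qcnj_in_S3 by metis
  define x where "x = u *\<^sub>q z"
  have x: "x \<in> S3" "x \<in> A"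
  proof -
    show "x \<in> S3"
      unfolding x_def using u z(1) by (rule qmult_in_S3)
    then show "x \<in> A"
      using p(3) z(2) by (auto simp: cap_def x_def inner_qmult_left)
  qed
  define W where "W = {w \<in> S3. w \<bullet> (x *\<^sub>q q) > cos t}"
  have "W \<subseteq> A \<otimes>\<^sub>q B"
  proof
    fix w assume w: "w \<in> W"
    have "qcnj x *\<^sub>q w \<in> S3"
      using w x(1) unfolding W_def by (intro qmult_in_S3 qcnj_in_S3) simp_all
    then have "qcnj x *\<^sub>q w \<in> B"
      using w q(3) by (auto simp: W_def cap_def inner_qmult_left)
    moreover have "w = x *\<^sub>q (qcnj x *\<^sub>q w)"
      by (simp add: qcnj_cancel[OF x(1)])
    ultimately show "w \<in> A \<otimes>\<^sub>q B"
      using x(2) unfolding set_qmult_def by blast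
  qed
  then have "u *\<^sub>q v \<notin> W"
    using bdry_not_in_open[OF uv openin_inner_gt] unfolding W_def by blast
  moreover have "(u *\<^sub>q v) \<bullet> (x *\<^sub>q q) = qcnj z \<bullet> (q *\<^sub>q qcnj v)"
  proof -
    have "(u *\<^sub>q v) \<bullet> (x *\<^sub>q q) = v \<bullet> (z *\<^sub>q q)"
      by (simp add: inner_qmult_left x_def qmult_assoc qcnj_cancel[OF u])
    also have "\<dots> = (qcnj z *\<^sub>q v) \<bullet> q"
      by (simp add: inner_qmult_left)
    finally show ?thesis
      by (simp add: inner_qmult_right)
  qed
  ultimately show False
    using z(3) qmult_in_S3[OF u v] by (simp add: W_def)
qed

text \<open>
  In terms of the common normal \<open>a\<close>, membership of a unit quaternion \<open>w\<close> in the cap of radius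
  \<open>r\<close> means \<open>w \<bullet> a \<ge> cot r (1 - Re w)\<close>, and \<open>cot\<close> is decreasing on \<open>(0, \<pi>)\<close>.
\<close>

lemma cap_mono_common_normal:
  assumes "s \<in> {0<..<pi}" "t \<in> {0<..<pi}" "s \<le> t"
    and "inward_normal p s = inward_normal q t"
  shows "cap p s \<subseteq> cap q t"
proof
  fix w assume w: "w \<in> cap p s"
  define a where "a = inward_normal p s"
  have pq: "p = cos s *\<^sub>R qone + sin s *\<^sub>R a" "q = cos t *\<^sub>R qone + sin t *\<^sub>R a"
    using center_eq assms a_def by metis+
  have sin: "sin s > 0" "sin t > 0" "sin (t - s) \<ge> 0"
    using assms(1-3) sin_gt_zero sin_ge_zero[of "t - s"] by auto
  have "w $ 1 \<le> 1"
    using w component_le_norm_cart[of w 1] by (simp add: cap_def)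
  then have "0 \<le> sin (t - s) * (1 - w $ 1)"
    using sin(3) by simp
  moreover have "sin t * cos s \<le> sin t * (w \<bullet> p)"
    using w sin(2) by (simp add: cap_def)
  ultimately have "sin s * cos t \<le> sin s * (w \<bullet> q)"
    unfolding pq by (simp add: inner_right_distrib inner_qone sin_diff algebra_simps)
  then show "w \<in> cap q t"
    using w sin(1) by (simp add: cap_def)
qed

section \<open>Boundary points of a product\<close>

theorem theorem4:
  fixes U V :: "quat set" and u v :: quat
  assumes "U \<subset> S3" and "V \<subset> S3"
    and "tame_boundary U" and "tame_boundary V"
    and "u \<in> bdry U" and "v \<in> bdry V"
    and "u *\<^sub>q v \<in> bdry (U \<otimes>\<^sub>q V)"
  shows "left_mult (qcnj u) (tangent_plane (bdry U) u)
           = right_mult (tangent_plane (bdry V) v) (qcnj v)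
       \<and> (\<forall>u0 \<in> S3. \<forall>v0 \<in> S3. \<forall>s \<in> {0<..<pi/2}. \<forall>t \<in> {0<..<pi/2}.
            cap u0 s \<subseteq> U \<and> tangent_at (bdry (cap u0 s)) (bdry U) u \<and>
            cap v0 t \<subseteq> V \<and> tangent_at (bdry (cap v0 t)) (bdry V) v \<longrightarrow>
              left_mult (qcnj u) (cap u0 s) \<subseteq> right_mult (cap v0 t) (qcnj v) \<or>
              right_mult (cap v0 t) (qcnj v) \<subseteq> left_mult (qcnj u) (cap u0 s))"
proof (intro conjI ballI impI; (elim conjE)?)
  have u: "u \<in> S3" and v: "v \<in> S3"
    using assms(5,6) bdry_subset_S3 by blast+
  {
    obtain p s where p: "p \<in> S3" "s \<in> {0<..<pi}" "cap p s \<subseteq> U" "u \<bullet> p = cos s"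
      using tame_boundary_obtain_cap[OF assms(3,1,5)] by blast
    obtain q t where q: "q \<in> S3" "t \<in> {0<..<pi}" "cap q t \<subseteq> V" "v \<bullet> q = cos t"
      using tame_boundary_obtain_cap[OF assms(4,2,6)] by blast
    define a where "a = inward_normal (qcnj u *\<^sub>q p) s"
    have "a = inward_normal (q *\<^sub>q qcnj v) t"
      unfolding a_def by (rule inward_normals_agree[OF u v assms(7) p q])
    then have pq: "qcnj u *\<^sub>q p = cos s *\<^sub>R qone + sin s *\<^sub>R a"
        "q *\<^sub>q qcnj v = cos t *\<^sub>R qone + sin t *\<^sub>R a"
      using center_eq p(2) q(2) a_def by metis+
    have sin: "sin s \<noteq> 0" "sin t \<noteq> 0"
      using p(2) q(2) sin_gt_zero by force+
    have "left_mult (qcnj u) (tangent_plane (bdry U) u) = {y. y \<bullet> qone = 0 \<and> y \<bullet> a = 0}"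
      unfolding tangent_plane_eq_orthogonal[OF assms(3,5) p] left_mult_Collect[OF u]
      using sin by (auto simp: inner_qmult_left qcnj_cancel[OF u] pq inner_right_distrib)
    moreover have "right_mult (tangent_plane (bdry V) v) (qcnj v) = {y. y \<bullet> qone = 0 \<and> y \<bullet> a = 0}"
      unfolding tangent_plane_eq_orthogonal[OF assms(4,6) q] right_mult_Collect[OF v]
      using sin by (auto simp: inner_qmult_right qcnj_cancel[OF v] pq inner_right_distrib)
    ultimately show "left_mult (qcnj u) (tangent_plane (bdry U) u)
        = right_mult (tangent_plane (bdry V) v) (qcnj v)"
      by simp
  }
  fix u0 v0 s t
  assume S3: "u0 \<in> S3" "v0 \<in> S3" and r: "s \<in> {0<..<pi/2}" "t \<in> {0<..<pi/2}"
    and cap: "cap u0 s \<subseteq> U" "cap v0 t \<subseteq> V"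
    and tangent: "tangent_at (bdry (cap u0 s)) (bdry U) u" "tangent_at (bdry (cap v0 t)) (bdry V) v"
  have st: "s \<in> {0<..<pi}" "t \<in> {0<..<pi}"
    using r by auto
  have "u \<in> cap u0 s" "v \<in> cap v0 t"
    using tangent bdry_cap_subset unfolding tangent_at_def by blast+
  then have "u \<bullet> u0 = cos s" "v \<bullet> v0 = cos t"
    using inner_eq_cos_on_bdry cap assms(5,6) by blast+
  then have normals: "inward_normal (qcnj u *\<^sub>q u0) s = inward_normal (v0 *\<^sub>q qcnj v) t"
    using inward_normals_agree[OF u v assms(7)] S3 st cap by blast
  show "left_mult (qcnj u) (cap u0 s) \<subseteq> right_mult (cap v0 t) (qcnj v) \<or>
        right_mult (cap v0 t) (qcnj v) \<subseteq> left_mult (qcnj u) (cap u0 s)"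
    unfolding left_mult_cap[OF u] right_mult_cap[OF v]
    using cap_mono_common_normal[OF st _ normals]
      cap_mono_common_normal[OF st(2,1) _ normals[symmetric]]
    by (meson linear)
qed

end
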